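(* Let $f,g:\mathbb{R}^n\to\mathbb{R}$ be convex, $F=f+g$, and assume that $f$ is differentiable and that $\nabla f$ is Lipschitz continuous with Lipschitz constant $L(f)$. Let $x^*$ be an optimal solution of $\min_{x\in\mathbb{R}^n}F(x)$. For $\mu\le 1/L(f)$, the iterates $y^k$ of the algorithm ALM-S (described in the context) satisfy $$F(y^k)-F(x^* )\le\frac{\|x^0-x^*\|^2}{2\mu(k+k_n)}\qquad\text{for all }k,$$ where $k_n$ is the number of iterations until the $k$-th (iteration indices $0,1,\dots,k-1$) for which the point $x$ computed in step 1 passes the test in step 2, i.e. the number of those iterations in which no skipping step occurs. Thus the sequence $\{F(y^k)\}$ produced by ALM-S converges to $F(x^* )$. Moreover, if $1/(\beta L(f))\le\mu\le 1/L(f)$ where $\beta\ge 1$, the number of iterations needed to obtain an $\epsilon$-optimal solution is at most $\lceil C/\epsilon\rceil$, where $C=\beta L(f)\|x^0-x^*\|^2/2$.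
   Context: $\|\cdot\|$ is the Euclidean norm. For $\mu>0$ define the augmented Lagrangian $$\mathcal{L}_\mu(x,y;\lambda):=f(x)+g(y)-\langle\lambda,x-y\rangle+\tfrac{1}{2\mu}\|x-y\|^2$$ and $$Q_f(u,v):=g(u)+f(v)+\langle\nabla f(v),u-v\rangle+\tfrac{1}{2\mu}\|u-v\|^2 .$$ A point $x_\epsilon\in\mathbb{R}^n$ is $\epsilon$-optimal if $F(x_\epsilon)-F(x^* )\le\epsilon$. Algorithm ALM-S (alternating linearization method with skipping steps). Choose $\mu>0$, $\lambda^0\in\mathbb{R}^n$ and $x^0=y^0\in\mathbb{R}^n$. For $k=0,1,2,\dots$: 1. $x^{k+1}:=\arg\min_x\mathcal{L}_\mu(x,y^k;\lambda^k)$. 2. If $F(x^{k+1})>\mathcal{L}_\mu(x^{k+1},y^k;\lambda^k)$, then $x^{k+1}:=y^k$ (a skipping step occurs). If instead $F(x^{k+1})\le\mathcal{L}_\mu(x^{k+1},y^k;\lambda^k)$, the test is passed, $x^{k+1}$ is kept, and no skipping step occurs. 3. $y^{k+1}:=\arg\min_y Q_f(y,x^{k+1})$. 4. $\lambda^{k+1}:=\nabla f(x^{k+1})-(x^{k+1}-y^{k+1})/\mu$.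
   Formalization: The rate (for k ≥ 1) and the iteration bound assume that, if iteration 0 passes the test, −λ^0 is a subgradient of g at y^0; for arbitrary λ^0 both fail. Convergence of F(y^k) is proved for every λ^0. *)

theory Defs
  imports "HOL-Analysis.Analysis"
begin

definition gradient :: "('a::real_inner \<Rightarrow> real) \<Rightarrow> 'a \<Rightarrow> 'a" where
  "gradient f v = (THE D. GDERIV f v :> D)"

definition is_subgradient :: "('a::real_inner \<Rightarrow> real) \<Rightarrow> 'a \<Rightarrow> 'a \<Rightarrow> bool" where
  "is_subgradient g v d \<longleftrightarrow> (\<forall>u. g v + d \<bullet> (u - v) \<le> g u)"

definition eps_optimal :: "('a \<Rightarrow> real) \<Rightarrow> 'a \<Rightarrow> real \<Rightarrow> 'a \<Rightarrow> bool" where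
  "eps_optimal F xstar \<epsilon> v \<longleftrightarrow> F v - F xstar \<le> \<epsilon>"

definition aug_lagrangian ::
  "('a::real_inner \<Rightarrow> real) \<Rightarrow> ('a \<Rightarrow> real) \<Rightarrow> real \<Rightarrow> 'a \<Rightarrow> 'a \<Rightarrow> 'a \<Rightarrow> real" where
  "aug_lagrangian f g \<mu> u v l = f u + g v - l \<bullet> (u - v) + 1 / (2 * \<mu>) * (norm (u - v))\<^sup>2"

definition Q_model ::
  "('a::real_inner \<Rightarrow> real) \<Rightarrow> ('a \<Rightarrow> real) \<Rightarrow> real \<Rightarrow> 'a \<Rightarrow> 'a \<Rightarrow> real" where
  "Q_model f g \<mu> u v =
     g u + f v + gradient f v \<bullet> (u - v) + 1 / (2 * \<mu>) * (norm (u - v))\<^sup>2"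

text \<open>In a run of ALM-S, \<open>xt k\<close> is the trial point computed in step 1 of iteration \<open>k\<close>, and
  \<open>x (Suc k)\<close> is the point in force after the skipping test, so that \<open>x (Suc k) = xt k\<close> unless
  iteration \<open>k\<close> is a skipping step.\<close>

definition passes_test ::
  "('a::real_inner \<Rightarrow> real) \<Rightarrow> ('a \<Rightarrow> real) \<Rightarrow> real \<Rightarrow>
   (nat \<Rightarrow> 'a) \<Rightarrow> (nat \<Rightarrow> 'a) \<Rightarrow> (nat \<Rightarrow> 'a) \<Rightarrow> nat \<Rightarrow> bool" where
  "passes_test f g \<mu> xt y l k \<longleftrightarrow>
     f (xt k) + g (xt k) \<le> aug_lagrangian f g \<mu> (xt k) (y k) (l k)"

definition alm_s_run ::
  "('a::real_inner \<Rightarrow> real) \<Rightarrow> ('a \<Rightarrow> real) \<Rightarrow> real \<Rightarrow>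
   (nat \<Rightarrow> 'a) \<Rightarrow> (nat \<Rightarrow> 'a) \<Rightarrow> (nat \<Rightarrow> 'a) \<Rightarrow> (nat \<Rightarrow> 'a) \<Rightarrow> bool" where
  "alm_s_run f g \<mu> xt x y l \<longleftrightarrow>
     x 0 = y 0 \<and>
     (\<forall>k. is_arg_min (\<lambda>u. aug_lagrangian f g \<mu> u (y k) (l k)) (\<lambda>_. True) (xt k) \<and>
          x (Suc k) = (if passes_test f g \<mu> xt y l k then xt k else y k) \<and>
          is_arg_min (\<lambda>u. Q_model f g \<mu> u (x (Suc k))) (\<lambda>_. True) (y (Suc k)) \<and>
          l (Suc k) = gradient f (x (Suc k)) - (x (Suc k) - y (Suc k)) /\<^sub>R \<mu>)"

definition num_passed ::
  "('a::real_inner \<Rightarrow> real) \<Rightarrow> ('a \<Rightarrow> real) \<Rightarrow> real \<Rightarrow>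
   (nat \<Rightarrow> 'a) \<Rightarrow> (nat \<Rightarrow> 'a) \<Rightarrow> (nat \<Rightarrow> 'a) \<Rightarrow> nat \<Rightarrow> nat" where
  "num_passed f g \<mu> xt y l k = card {i. i < k \<and> passes_test f g \<mu> xt y l i}"

text \<open>The step-4 update makes \<open>- l k\<close> a subgradient of \<open>g\<close> at \<open>y k\<close> for every \<open>k > 0\<close>, but
  the initial multiplier \<open>l 0\<close> is a free input for which this can fail. If it fails and the first
  trial point nevertheless passes the test, the rate in terms of \<open>(norm (x 0 - xstar))\<^sup>2\<close> is
  false: take \<open>f = 0\<close>, \<open>g u = 200 * max u 0 + 5 * max (- u) 0\<close> on the real line, \<open>\<mu> = 1\<close>,
  \<open>x 0 = y 0 = 1\<close> and \<open>l 0 = - 11\<close>. Then \<open>xt 0 = - 10\<close> passes the test and \<open>y 1 = - 5\<close>,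
  so \<open>g (y 1) = 25\<close>, whereas the bound for \<open>k = 1\<close> would be \<open>1 / 4\<close>.\<close>

definition admissible_start ::
  "('a::real_inner \<Rightarrow> real) \<Rightarrow> ('a \<Rightarrow> real) \<Rightarrow> real \<Rightarrow>
   (nat \<Rightarrow> 'a) \<Rightarrow> (nat \<Rightarrow> 'a) \<Rightarrow> (nat \<Rightarrow> 'a) \<Rightarrow> bool" where
  "admissible_start f g \<mu> xt y l \<longleftrightarrow>
     (passes_test f g \<mu> xt y l 0 \<longrightarrow> is_subgradient g (y 0) (- l 0))"

end

theory Submission
  imports Defs
begin

text \<open>Minimising a convex function \<open>h\<close> plus a quadratic of curvature \<open>1/\<mu>\<close> makes the objective grow
  at least like \<open>\<parallel>u - y\<parallel>\<^sup>2 / (2\<mu>)\<close> away from the minimiser \<open>y\<close>. For step 3 the descent lemma,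
  and for a step 1 that is not skipped the test itself, shows that the minimal value majorises \<open>F\<close>
  at the new point, while convexity (respectively \<open>- \<lambda>\<^sup>k\<close> being a subgradient of \<open>g\<close> at \<open>y\<^sup>k\<close>)
  bounds the value at \<open>u\<close> by \<open>F u\<close>. Either way a step from \<open>v\<close> to \<open>p\<close> satisfies
  \<open>F p + \<parallel>u - p\<parallel>\<^sup>2 / (2\<mu>) \<le> F u + \<parallel>u - v\<parallel>\<^sup>2 / (2\<mu>)\<close> for every \<open>u\<close>. With \<open>u = v\<close> this gives monotonicity,
  and with \<open>u = x\<^sup>*\<close> the sums telescope, each iteration contributing one term, or two if the
  test is passed. Convergence needs no condition on \<open>\<lambda>\<^sup>0\<close>, because the run from index 1 on
  starts with a valid multiplier.\<close>

section \<open>Gradients, tangent inequality and descent lemma\<close>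

lemma GDERIV_gradient:
  fixes f :: "'a::euclidean_space \<Rightarrow> real"
  assumes "f differentiable (at v)"
  shows "GDERIV f v :> gradient f v"
proof -
  obtain f' where f': "(f has_derivative f') (at v)"
    using assms by (auto simp: differentiable_def)
  \<comment> \<open>Riesz representation: the adjoint of the functional \<open>f'\<close>, applied
    to 1, is the vector representing it. Uniqueness is shown afterwards because
    \<open>gradient\<close> is a definite description.\<close>
  have "f' = (\<lambda>h. h \<bullet> adjoint f' 1)"
    using adjoint_works[OF has_derivative_linear[OF f'], where y = 1] by simp
  then have D: "GDERIV f v :> adjoint f' 1"
    using f' by (simp add: gderiv_def)
  have "d = adjoint f' 1" if "GDERIV f v :> d" for d
  proof -
    have "(\<lambda>h. h \<bullet> d) = (\<lambda>h. h \<bullet> adjoint f' 1)"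
      using that D unfolding gderiv_def by (rule has_derivative_unique)
    then show ?thesis by (simp add: fun_eq_iff vector_eq_ldot)
  qed
  then have "gradient f v = adjoint f' 1"
    unfolding gradient_def using D by (intro the_equality)
  then show ?thesis using D by simp
qed

lemma has_real_derivative_along_line:
  fixes f :: "'a::euclidean_space \<Rightarrow> real"
  assumes "f differentiable (at (v + t *\<^sub>R w))"
  shows "((\<lambda>t. f (v + t *\<^sub>R w)) has_real_derivative gradient f (v + t *\<^sub>R w) \<bullet> w) (at t)"
proof -
  have "((\<lambda>t. v + t *\<^sub>R w) has_derivative (\<lambda>s. s *\<^sub>R w)) (at t)"
    by (auto intro!: derivative_eq_intros)
  moreover have "(f has_derivative (\<lambda>h. h \<bullet> gradient f (v + t *\<^sub>R w))) (at (v + t *\<^sub>R w))"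
    using GDERIV_gradient[OF assms] by (simp add: gderiv_def)
  ultimately have "((\<lambda>t. f (v + t *\<^sub>R w)) has_derivative
      (\<lambda>s. (s *\<^sub>R w) \<bullet> gradient f (v + t *\<^sub>R w))) (at t)"
    by (rule has_derivative_compose)
  then show ?thesis
    unfolding has_field_derivative_def
    by (rule has_derivative_eq_rhs) (simp add: fun_eq_iff inner_commute mult.commute)
qed

text \<open>Reduces to one variable: along the line through \<open>v\<close> and \<open>u\<close>
  the function stays convex, so its tangent at 0 lies below its value at 1.\<close>

lemma convex_on_gradient_le:
  fixes f :: "'a::euclidean_space \<Rightarrow> real"
  assumes "convex_on UNIV f" "f differentiable (at v)"
  shows "f v + gradient f v \<bullet> (u - v) \<le> f u"
proof -
  let ?\<phi> = "\<lambda>t. f (v + t *\<^sub>R (u - v))"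
  have "convex_on UNIV ?\<phi>"
  proof (intro convex_onI)
    fix t a b :: real
    assume "0 < t" "t < 1"
    moreover have "v + ((1 - t) *\<^sub>R a + t *\<^sub>R b) *\<^sub>R (u - v)
        = (1 - t) *\<^sub>R (v + a *\<^sub>R (u - v)) + t *\<^sub>R (v + b *\<^sub>R (u - v))"
      by (simp add: algebra_simps)
    ultimately show "?\<phi> ((1 - t) *\<^sub>R a + t *\<^sub>R b) \<le> (1 - t) * ?\<phi> a + t * ?\<phi> b"
      using convex_onD[OF assms(1)] by simp
  qed simp
  moreover have "(?\<phi> has_real_derivative gradient f v \<bullet> (u - v)) (at 0)"
    using has_real_derivative_along_line[of f v 0 "u - v"] assms(2) by simp
  ultimately have "gradient f v \<bullet> (u - v) * (1 - 0) \<le> ?\<phi> 1 - ?\<phi> 0"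
    by (intro convex_on_imp_above_tangent) auto
  then show ?thesis by simp
qed

lemma descent_lemma:
  fixes f :: "'a::euclidean_space \<Rightarrow> real"
  assumes "\<And>u. f differentiable (at u)" and "L-lipschitz_on UNIV (gradient f)"
  shows "f u \<le> f v + gradient f v \<bullet> (u - v) + L / 2 * (norm (u - v))\<^sup>2"
proof -
  define w where "w = u - v"
  \<comment> \<open>Subtracting the claimed growth along the segment leaves a function whose
    derivative is at most 0 on [0, 1], by Cauchy-Schwarz and the Lipschitz bound. This replaces
    integrating the gradient.\<close>
  let ?\<phi> = "\<lambda>t. f (v + t *\<^sub>R w) - t * (gradient f v \<bullet> w) - L / 2 * (norm w)\<^sup>2 * t\<^sup>2"
  have "?\<phi> 1 \<le> ?\<phi> 0"
  proof (rule DERIV_nonpos_imp_nonincreasing[where f = ?\<phi>])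
    fix t :: real
    assume t: "0 \<le> t" "t \<le> 1"
    let ?d = "gradient f (v + t *\<^sub>R w) \<bullet> w - gradient f v \<bullet> w - L * (norm w)\<^sup>2 * t"
    have "(?\<phi> has_real_derivative ?d) (at t)"
      by (auto intro!: derivative_eq_intros has_real_derivative_along_line assms(1))
    moreover have "?d \<le> 0"
    proof -
      have "(gradient f (v + t *\<^sub>R w) - gradient f v) \<bullet> w
          \<le> norm (gradient f (v + t *\<^sub>R w) - gradient f v) * norm w"
        by (rule norm_cauchy_schwarz)
      also have "\<dots> \<le> (L * norm (t *\<^sub>R w)) * norm w"
        using lipschitz_onD[OF assms(2), of "v + t *\<^sub>R w" v]
        by (intro mult_right_mono) (auto simp: dist_norm)
      finally show ?thesis
        using t by (simp add: inner_diff_left power2_eq_square mult_ac)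
    qed
    ultimately show "\<exists>d. (?\<phi> has_real_derivative d) (at t) \<and> d \<le> 0" by blast
  qed simp
  then show ?thesis by (simp add: w_def)
qed

section \<open>Proximal minimisation of a convex function plus a linear term\<close>

lemma norm_add_scaleR_sq:
  fixes a b :: "'a::real_inner"
  shows "(norm (a + t *\<^sub>R b))\<^sup>2 = (norm a)\<^sup>2 + 2 * t * (a \<bullet> b) + t\<^sup>2 * (norm b)\<^sup>2"
  unfolding power2_norm_eq_inner
  by (simp add: inner_simps inner_commute power2_eq_square algebra_simps)

text \<open>First-order optimality by a one-sided limit: compare \<open>p\<close> with
  \<open>p + t *\<^sub>R w\<close>, divide by \<open>t\<close> and let \<open>t\<close> tend to 0
  from the right. The linear term \<open>c\<close> will be \<open>gradient f v\<close> in step 3 and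
  \<open>- l\<close> in step 1.\<close>

lemma is_subgradient_prox:
  fixes h :: "'a::real_inner \<Rightarrow> real"
  assumes "convex_on UNIV h" "0 < \<mu>"
    and min: "\<And>u. h p + c \<bullet> p + 1 / (2 * \<mu>) * (norm (p - v))\<^sup>2
               \<le> h u + c \<bullet> u + 1 / (2 * \<mu>) * (norm (u - v))\<^sup>2"
  shows "is_subgradient h p (- (c + (p - v) /\<^sub>R \<mu>))"
  unfolding is_subgradient_def
proof
  fix u
  define w where "w = u - p"
  \<comment> \<open>\<open>S\<close> is the slack of the subgradient inequality at \<open>u\<close>;
    \<open>t * r\<close> is the rest of the quadratic after division by \<open>t\<close>.\<close>
  define S where "S = h u - h p + c \<bullet> w + (p - v) \<bullet> w / \<mu>"
  define r where "r = (norm w)\<^sup>2 / (2 * \<mu>)"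
  have le: "0 \<le> S + t * r" if t: "0 < t" "t < 1" for t
  proof -
    have "h (p + t *\<^sub>R w) = h ((1 - t) *\<^sub>R p + t *\<^sub>R u)"
      by (simp add: w_def algebra_simps)
    also have "\<dots> \<le> (1 - t) * h p + t * h u"
      using t by (intro convex_onD[OF assms(1)]) auto
    finally have conv: "h (p + t *\<^sub>R w) \<le> (1 - t) * h p + t * h u" .
    have sq: "(norm (p + t *\<^sub>R w - v))\<^sup>2
        = (norm (p - v))\<^sup>2 + 2 * t * ((p - v) \<bullet> w) + t\<^sup>2 * (norm w)\<^sup>2"
      using norm_add_scaleR_sq[of "p - v" t w] by (simp add: algebra_simps)
    have "1 / (2 * \<mu>) * (norm (p + t *\<^sub>R w - v))\<^sup>2
        = 1 / (2 * \<mu>) * (norm (p - v))\<^sup>2 + t * ((p - v) \<bullet> w / \<mu>) + t * (t * r)"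
      unfolding sq r_def using assms(2) by (simp add: field_simps power2_eq_square)
    with min[of "p + t *\<^sub>R w"] conv have "0 \<le> t * (S + t * r)"
      by (simp add: S_def inner_simps algebra_simps)
    with t show ?thesis by (simp add: zero_le_mult_iff)
  qed
  have "0 \<le> S"
  proof (rule tendsto_lowerbound)
    show "((\<lambda>t. S + t * r) \<longlongrightarrow> S) (at_right 0)"
      by (auto intro!: tendsto_eq_intros)
    show "\<forall>\<^sub>F t in at_right 0. 0 \<le> S + t * r"
      unfolding eventually_at_right_field using le by (intro exI[of _ 1]) auto
  qed simp
  moreover have "- (c + (p - v) /\<^sub>R \<mu>) \<bullet> (u - p) = h u - h p - S"
    by (simp add: S_def w_def inner_simps divide_inverse algebra_simps)
  ultimately show "h p + - (c + (p - v) /\<^sub>R \<mu>) \<bullet> (u - p) \<le> h u" by simp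
qed

text \<open>The inner product produced by the subgradient at \<open>p\<close> is exactly the cross
  term in the expansion of \<open>(norm ((p - v) + (u - p)))\<^sup>2\<close>.\<close>

lemma prox_three_point:
  fixes h :: "'a::real_inner \<Rightarrow> real"
  assumes "convex_on UNIV h" "0 < \<mu>"
    and "\<And>u. h p + c \<bullet> p + 1 / (2 * \<mu>) * (norm (p - v))\<^sup>2
               \<le> h u + c \<bullet> u + 1 / (2 * \<mu>) * (norm (u - v))\<^sup>2"
  shows "h p + c \<bullet> p + 1 / (2 * \<mu>) * (norm (p - v))\<^sup>2 + 1 / (2 * \<mu>) * (norm (u - p))\<^sup>2
           \<le> h u + c \<bullet> u + 1 / (2 * \<mu>) * (norm (u - v))\<^sup>2"
proof -
  have "h p + - (c + (p - v) /\<^sub>R \<mu>) \<bullet> (u - p) \<le> h u"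
    using is_subgradient_prox[OF assms] by (simp add: is_subgradient_def)
  then have "h p + c \<bullet> p \<le> h u + c \<bullet> u + (p - v) \<bullet> (u - p) / \<mu>"
    by (simp add: inner_simps divide_inverse algebra_simps)
  moreover have "(norm (u - v))\<^sup>2 = (norm (p - v))\<^sup>2 + 2 * ((p - v) \<bullet> (u - p)) + (norm (u - p))\<^sup>2"
    using norm_add_scaleR_sq[of "p - v" 1 "u - p"] by simp
  then have "1 / (2 * \<mu>) * (norm (u - v))\<^sup>2 = 1 / (2 * \<mu>) * (norm (p - v))\<^sup>2
      + (p - v) \<bullet> (u - p) / \<mu> + 1 / (2 * \<mu>) * (norm (u - p))\<^sup>2"
    using assms(2) by (simp add: field_simps)
  ultimately show ?thesis by simp
qed

section \<open>The two minimisation steps of an iteration\<close>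

lemma Q_model_step:
  fixes f g :: "'a::euclidean_space \<Rightarrow> real"
  assumes "convex_on UNIV f" "convex_on UNIV g" "\<And>u. f differentiable (at u)"
    and "0 < L" "L-lipschitz_on UNIV (gradient f)" "0 < \<mu>" "\<mu> \<le> 1 / L"
    and min: "is_arg_min (\<lambda>u. Q_model f g \<mu> u v) (\<lambda>_. True) p"
  shows "f p + g p + 1 / (2 * \<mu>) * (norm (u - p))\<^sup>2 \<le> f u + g u + 1 / (2 * \<mu>) * (norm (u - v))\<^sup>2"
    and "is_subgradient g p (- (gradient f v - (v - p) /\<^sub>R \<mu>))"
proof -
  \<comment> \<open>Up to a term constant in \<open>u\<close>, \<open>Q_model\<close> is a proximal
    objective for \<open>g\<close> with \<open>c = gradient f v\<close>.\<close>
  have min': "g p + gradient f v \<bullet> p + 1 / (2 * \<mu>) * (norm (p - v))\<^sup>2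
      \<le> g u + gradient f v \<bullet> u + 1 / (2 * \<mu>) * (norm (u - v))\<^sup>2" for u
  proof -
    have "Q_model f g \<mu> p v \<le> Q_model f g \<mu> u v"
      using min by (simp add: is_arg_min_linorder)
    then show ?thesis unfolding Q_model_def inner_diff_right by linarith
  qed
  have "f p \<le> f v + gradient f v \<bullet> (p - v) + L / 2 * (norm (p - v))\<^sup>2"
    using assms(3,5) by (rule descent_lemma)
  \<comment> \<open>The step-size bound enters here, as \<open>L \<le> 1 / \<mu>\<close>.\<close>
  also have "L / 2 * (norm (p - v))\<^sup>2 \<le> 1 / (2 * \<mu>) * (norm (p - v))\<^sup>2"
    using assms(4,6,7) by (intro mult_right_mono) (auto simp: field_simps)
  finally have "f p \<le> f v + gradient f v \<bullet> (p - v) + 1 / (2 * \<mu>) * (norm (p - v))\<^sup>2" by simp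
  moreover have "f v + gradient f v \<bullet> (u - v) \<le> f u"
    using assms(1,3) by (rule convex_on_gradient_le)
  ultimately show "f p + g p + 1 / (2 * \<mu>) * (norm (u - p))\<^sup>2
      \<le> f u + g u + 1 / (2 * \<mu>) * (norm (u - v))\<^sup>2"
    using prox_three_point[OF assms(2,6) min', of u] by (simp add: inner_simps)
  \<comment> \<open>The left side is minus the multiplier set in step 4: that update records the
    subgradient found in step 3.\<close>
  have "- (gradient f v - (v - p) /\<^sub>R \<mu>) = - (gradient f v + (p - v) /\<^sub>R \<mu>)"
    by (simp add: algebra_simps)
  then show "is_subgradient g p (- (gradient f v - (v - p) /\<^sub>R \<mu>))"
    using is_subgradient_prox[OF assms(2,6) min'] by simp
qed

text \<open>Mirror image of \<open>Q_model_step\<close>: now \<open>f\<close> is kept and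
  \<open>g\<close> is linearised at \<open>v\<close> with slope \<open>- l\<close>. The passed test
  stands in for the descent lemma, since \<open>g\<close> may be nonsmooth.\<close>

lemma aug_lagrangian_step:
  fixes f g :: "'a::real_inner \<Rightarrow> real"
  assumes "convex_on UNIV f" "0 < \<mu>" "is_subgradient g v (- l)"
    and min: "is_arg_min (\<lambda>u. aug_lagrangian f g \<mu> u v l) (\<lambda>_. True) p"
    and test: "f p + g p \<le> aug_lagrangian f g \<mu> p v l"
  shows "f p + g p + 1 / (2 * \<mu>) * (norm (u - p))\<^sup>2 \<le> f u + g u + 1 / (2 * \<mu>) * (norm (u - v))\<^sup>2"
proof -
  have min': "f p + (- l) \<bullet> p + 1 / (2 * \<mu>) * (norm (p - v))\<^sup>2
      \<le> f u + (- l) \<bullet> u + 1 / (2 * \<mu>) * (norm (u - v))\<^sup>2" for u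
  proof -
    have "aug_lagrangian f g \<mu> p v l \<le> aug_lagrangian f g \<mu> u v l"
      using min by (simp add: is_arg_min_linorder)
    then show ?thesis unfolding aug_lagrangian_def inner_diff_right inner_minus_left by linarith
  qed
  have "g v + (- l) \<bullet> (u - v) \<le> g u"
    using assms(3) by (simp add: is_subgradient_def)
  then show ?thesis
    using test prox_three_point[OF assms(1,2) min', of u]
    by (simp add: aug_lagrangian_def inner_simps)
qed

lemma num_passed_0: "num_passed f g \<mu> xt y l 0 = 0"
  by (simp add: num_passed_def)

lemma num_passed_Suc:
  "num_passed f g \<mu> xt y l (Suc k)
    = num_passed f g \<mu> xt y l k + (if passes_test f g \<mu> xt y l k then 1 else 0)"
proof -
  have "{i. i < Suc k \<and> passes_test f g \<mu> xt y l i} =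
      (if passes_test f g \<mu> xt y l k then insert k else id) {i. i < k \<and> passes_test f g \<mu> xt y l i}"
    by (auto simp: less_Suc_eq)
  then show ?thesis by (simp add: num_passed_def)
qed

lemma alm_s_runD:
  assumes "alm_s_run f g \<mu> xt x y l"
  shows "x 0 = y 0"
    and "is_arg_min (\<lambda>u. aug_lagrangian f g \<mu> u (y k) (l k)) (\<lambda>_. True) (xt k)"
    and "x (Suc k) = (if passes_test f g \<mu> xt y l k then xt k else y k)"
    and "is_arg_min (\<lambda>u. Q_model f g \<mu> u (x (Suc k))) (\<lambda>_. True) (y (Suc k))"
    and "l (Suc k) = gradient f (x (Suc k)) - (x (Suc k) - y (Suc k)) /\<^sub>R \<mu>"
  using assms unfolding alm_s_run_def by blast+

text \<open>Provides the multiplier condition of \<open>aug_lagrangian_step\<close> at every index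
  after 0, whatever \<open>l 0\<close> is.\<close>

lemma alm_s_run_subgradient:
  fixes f g :: "'a::euclidean_space \<Rightarrow> real"
  assumes "convex_on UNIV f" "convex_on UNIV g" "\<And>u. f differentiable (at u)"
    and "0 < L" "L-lipschitz_on UNIV (gradient f)" "0 < \<mu>" "\<mu> \<le> 1 / L"
    and run: "alm_s_run f g \<mu> xt x y l"
  shows "is_subgradient g (y (Suc k)) (- l (Suc k))"
  unfolding alm_s_runD(5)[OF run]
  by (rule Q_model_step(2)[OF assms(1-7) alm_s_runD(4)[OF run]])

text \<open>Telescoping in the form of an invariant: the left side never increases with
  \<open>k\<close> and starts at the right side. The comparison point \<open>z\<close> is
  arbitrary.\<close>

lemma alm_s_run_potential:
  fixes f g :: "'a::euclidean_space \<Rightarrow> real"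
  assumes "convex_on UNIV f" "convex_on UNIV g" "\<And>u. f differentiable (at u)"
    and "0 < L" "L-lipschitz_on UNIV (gradient f)" "0 < \<mu>" "\<mu> \<le> 1 / L"
    and run: "alm_s_run f g \<mu> xt x y l" and start: "admissible_start f g \<mu> xt y l"
  shows "2 * \<mu> * real (k + num_passed f g \<mu> xt y l k) * (f (y k) + g (y k) - (f z + g z))
           + (norm (z - y k))\<^sup>2 \<le> (norm (z - x 0))\<^sup>2"
proof (induction k)
  case 0
  then show ?case using alm_s_runD(1)[OF run] by (simp add: num_passed_0)
next
  case (Suc k)
  define a where "a v = f v + g v - (f z + g z)" for v
  define N where "N = real (k + num_passed f g \<mu> xt y l k)"
  \<comment> \<open>Only index 0 draws on the starting condition; later multipliers come from step
    4.\<close>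
  have sub: "is_subgradient g (y k) (- l k)" if "passes_test f g \<mu> xt y l k"
  proof (cases k)
    case 0
    then show ?thesis using start that by (simp add: admissible_start_def)
  next
    case (Suc j)
    then show ?thesis
      using alm_s_run_subgradient[OF assms(1-8)] by simp
  qed
  have scale: "2 * \<mu> * a p + (norm (z - p))\<^sup>2 \<le> (norm (z - v))\<^sup>2"
    if "f p + g p + 1 / (2 * \<mu>) * (norm (z - p))\<^sup>2 \<le> f z + g z + 1 / (2 * \<mu>) * (norm (z - v))\<^sup>2"
    for p v
    using mult_left_mono[OF that, of "2 * \<mu>"] assms(6)
    by (simp add: a_def distrib_left right_diff_distrib)
  \<comment> \<open>Here the comparison point is the origin \<open>v\<close> of the step, so the
    quadratic on the right vanishes.\<close>
  have mono: "a p \<le> a v"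
    if "f p + g p + 1 / (2 * \<mu>) * (norm (v - p))\<^sup>2 \<le> f v + g v + 1 / (2 * \<mu>) * (norm (v - v))\<^sup>2"
    for p v
  proof -
    have "0 \<le> 1 / (2 * \<mu>) * (norm (v - p))\<^sup>2" using assms(6) by simp
    then show ?thesis using that by (simp add: a_def)
  qed
  note Y = Q_model_step(1)[OF assms(1-7) alm_s_runD(4)[OF run]]
  have y1: "2 * \<mu> * a (y (Suc k)) + (norm (z - y (Suc k)))\<^sup>2 \<le> (norm (z - x (Suc k)))\<^sup>2"
    and y2: "a (y (Suc k)) \<le> a (x (Suc k))"
    by (rule scale[OF Y], rule mono[OF Y])
  have IH: "2 * \<mu> * N * a (y k) + (norm (z - y k))\<^sup>2 \<le> (norm (z - x 0))\<^sup>2"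
    using Suc.IH by (simp add: a_def N_def)
  \<comment> \<open>A nonnegative weight lets the terms gathered so far be re-evaluated at the
    newer, lower value.\<close>
  have "0 \<le> 2 * \<mu> * N" using assms(6) by (simp add: N_def)
  note N_mono = mult_left_mono[OF _ this]
  show ?case
  proof (cases "passes_test f g \<mu> xt y l k")
    case True
    have xt: "x (Suc k) = xt k"
      using alm_s_runD(3)[OF run, of k] True by simp
    note X = aug_lagrangian_step[OF assms(1,6) sub[OF True] alm_s_runD(2)[OF run]
        True[unfolded passes_test_def]]
    have x1: "2 * \<mu> * a (x (Suc k)) + (norm (z - x (Suc k)))\<^sup>2 \<le> (norm (z - y k))\<^sup>2"
      and x2: "a (x (Suc k)) \<le> a (y k)"
      unfolding xt by (rule scale[OF X], rule mono[OF X])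
    \<comment> \<open>Steps 1 and 3 each add a term, and both are bounded below by the value at
      \<open>y (Suc k)\<close>; hence the weight grows by two.\<close>
    have "2 * \<mu> * N * a (y (Suc k)) \<le> 2 * \<mu> * N * a (y k)"
      using y2 x2 by (intro N_mono) simp
    moreover have "2 * \<mu> * a (y (Suc k)) \<le> 2 * \<mu> * a (x (Suc k))"
      using y2 assms(6) by simp
    moreover have "2 * \<mu> * real (Suc k + num_passed f g \<mu> xt y l (Suc k)) * a (y (Suc k))
        = 2 * \<mu> * N * a (y (Suc k)) + 2 * \<mu> * a (y (Suc k)) + 2 * \<mu> * a (y (Suc k))"
      using True by (simp add: num_passed_Suc N_def algebra_simps)
    ultimately have "2 * \<mu> * real (Suc k + num_passed f g \<mu> xt y l (Suc k)) * a (y (Suc k))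
        + (norm (z - y (Suc k)))\<^sup>2 \<le> (norm (z - x 0))\<^sup>2"
      using y1 x1 IH by linarith
    then show ?thesis by (simp only: a_def)
  next
    case False
    then have xy: "x (Suc k) = y k"
      using alm_s_runD(3)[OF run, of k] by simp
    \<comment> \<open>After a skip, step 3 starts from \<open>y k\<close> itself, and the weight
      grows by one.\<close>
    have "2 * \<mu> * N * a (y (Suc k)) \<le> 2 * \<mu> * N * a (y k)"
      using y2 by (intro N_mono) (simp add: xy)
    moreover have "2 * \<mu> * real (Suc k + num_passed f g \<mu> xt y l (Suc k)) * a (y (Suc k))
        = 2 * \<mu> * N * a (y (Suc k)) + 2 * \<mu> * a (y (Suc k))"
      using False by (simp add: num_passed_Suc N_def algebra_simps)
    ultimately have "2 * \<mu> * real (Suc k + num_passed f g \<mu> xt y l (Suc k)) * a (y (Suc k))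
        + (norm (z - y (Suc k)))\<^sup>2 \<le> (norm (z - x 0))\<^sup>2"
      using y1 IH unfolding xy by linarith
    then show ?thesis by (simp only: a_def)
  qed
qed

section \<open>Rate, convergence and iteration count\<close>

lemma alm_s_run_rate:
  fixes f g :: "'a::euclidean_space \<Rightarrow> real"
  assumes "convex_on UNIV f" "convex_on UNIV g" "\<And>u. f differentiable (at u)"
    and "0 < L" "L-lipschitz_on UNIV (gradient f)" "0 < \<mu>" "\<mu> \<le> 1 / L"
    and "alm_s_run f g \<mu> xt x y l" "admissible_start f g \<mu> xt y l" "1 \<le> k"
  shows "f (y k) + g (y k) - (f z + g z)
           \<le> (norm (x 0 - z))\<^sup>2 / (2 * \<mu> * real (k + num_passed f g \<mu> xt y l k))"
proof -
  let ?N = "real (k + num_passed f g \<mu> xt y l k)"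
  \<comment> \<open>This needs \<open>1 \<le> k\<close>: at \<open>k = 0\<close> the bound would be
    a division by zero, hence 0.\<close>
  have "0 < 2 * \<mu> * ?N" using assms(6,10) by (simp add: mult_pos_pos)
  moreover have "2 * \<mu> * ?N * (f (y k) + g (y k) - (f z + g z)) \<le> (norm (x 0 - z))\<^sup>2"
    using alm_s_run_potential[OF assms(1-9), of k z] zero_le_power2[of "norm (z - y k)"]
    unfolding norm_minus_commute[of "x 0" z] by linarith
  ultimately show ?thesis by (simp only: pos_le_divide_eq mult.commute)
qed

text \<open>Dropping iteration 0 yields a run again. Its initial point is reset to
  \<open>y 1\<close>, because a run must start with equal points and \<open>x 1\<close> may differ
  from \<open>y 1\<close>.\<close>

lemma alm_s_run_shift:
  assumes "alm_s_run f g \<mu> xt x y l"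
  shows "alm_s_run f g \<mu> (\<lambda>k. xt (Suc k)) (\<lambda>k. if k = 0 then y 1 else x (Suc k))
           (\<lambda>k. y (Suc k)) (\<lambda>k. l (Suc k))"
proof -
  have pass: "passes_test f g \<mu> (\<lambda>k. xt (Suc k)) (\<lambda>k. y (Suc k)) (\<lambda>k. l (Suc k)) k
      \<longleftrightarrow> passes_test f g \<mu> xt y l (Suc k)" for k
    by (simp add: passes_test_def)
  show ?thesis
    \<comment> \<open>The rewriting turns \<open>Suc k = 0\<close> into \<open>False\<close>, so the
      conditional survives only at index 0.\<close>
    unfolding alm_s_run_def pass nat.simps(3)[THEN Eq_FalseI] if_False
    by (intro conjI allI alm_s_runD(2-5)[OF assms]) simp
qed

theorem theorem2p3:
  fixes f g F :: "real ^ 'n \<Rightarrow> real"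
    and L \<mu> :: real
    and xstar :: "real ^ 'n"
    and xt x y l :: "nat \<Rightarrow> real ^ 'n"
  assumes "convex_on UNIV f"
    and "convex_on UNIV g"
    and "\<And>u. F u = f u + g u"
    and "\<And>u. f differentiable (at u)"
    and "0 < L"
    and "L-lipschitz_on UNIV (gradient f)"
    and "is_arg_min F (\<lambda>_. True) xstar"
    and "0 < \<mu>"
    and "\<mu> \<le> 1 / L"
    and "alm_s_run f g \<mu> xt x y l"
  shows "(admissible_start f g \<mu> xt y l \<longrightarrow>
           (\<forall>k\<ge>1. F (y k) - F xstar
              \<le> (norm (x 0 - xstar))\<^sup>2 / (2 * \<mu> * real (k + num_passed f g \<mu> xt y l k)))) \<and>
         (\<lambda>k. F (y k)) \<longlonglongrightarrow> F xstar \<and>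
         (admissible_start f g \<mu> xt y l \<longrightarrow>
           (\<forall>\<beta> \<epsilon>. 1 \<le> \<beta> \<and> 1 / (\<beta> * L) \<le> \<mu> \<and> 0 < \<epsilon> \<longrightarrow>
              (\<forall>k. \<lceil>(\<beta> * L * (norm (x 0 - xstar))\<^sup>2 / 2) / \<epsilon>\<rceil> \<le> int k \<longrightarrow>
                 eps_optimal F xstar \<epsilon> (y k))))"
proof -
  note params = assms(1,2,4-6,8,9)
  have opt: "F xstar \<le> F u" for u
    using assms(7) by (simp add: is_arg_min_linorder)
  define R where "R = (norm (x 0 - xstar))\<^sup>2"
  have rate: "F (y k) - F xstar \<le> R / (2 * \<mu> * real (k + num_passed f g \<mu> xt y l k))"
    if "admissible_start f g \<mu> xt y l" "1 \<le> k" for k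
    using alm_s_run_rate[OF params assms(10) that] by (simp add: assms(3) R_def)
  have "(\<lambda>k. F (y (Suc k))) \<longlonglongrightarrow> F xstar"
  proof -
    let ?y = "\<lambda>k. y (Suc k)" and ?xt = "\<lambda>k. xt (Suc k)" and ?l = "\<lambda>k. l (Suc k)"
    define r where "r = (norm (y 1 - xstar))\<^sup>2 / (2 * \<mu>)"
    \<comment> \<open>The shifted run begins with \<open>l 1\<close>, set by step 4; the price is a
      rate in terms of the distance from \<open>y 1\<close>.\<close>
    have start: "admissible_start f g \<mu> ?xt ?y ?l"
      using alm_s_run_subgradient[OF params assms(10)] by (simp add: admissible_start_def)
    have "F (?y k) \<le> F xstar + r / real k" if "1 \<le> k" for k
    proof -
      have "F (?y k) - F xstar \<le> (norm (y 1 - xstar))\<^sup>2 /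
          (2 * \<mu> * real (k + num_passed f g \<mu> ?xt ?y ?l k))"
        using alm_s_run_rate[OF params alm_s_run_shift[OF assms(10)] start that]
        by (simp add: assms(3))
      also have "\<dots> \<le> (norm (y 1 - xstar))\<^sup>2 / (2 * \<mu> * real k)"
        using that assms(8) by (intro divide_left_mono mult_left_mono mult_pos_pos) auto
      finally show ?thesis by (simp add: r_def)
    qed
    then have "\<forall>\<^sub>F k in sequentially. F (?y k) \<le> F xstar + r / real k"
      by (auto simp: eventually_sequentially)
    moreover have "(\<lambda>k. F xstar + r / real k) \<longlonglongrightarrow> F xstar"
      using tendsto_add[OF tendsto_const lim_const_over_n[of r], of "F xstar"] by simp
    ultimately show ?thesis
      by (rule tendsto_sandwich[OF always_eventually[OF allI[OF opt]] _ tendsto_const])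
  qed
  then have lim: "(\<lambda>k. F (y k)) \<longlonglongrightarrow> F xstar"
    by (rule LIMSEQ_imp_Suc)
  have eps: "eps_optimal F xstar \<epsilon> (y k)"
    if start: "admissible_start f g \<mu> xt y l" and \<beta>: "1 \<le> \<beta>" "1 / (\<beta> * L) \<le> \<mu>" and "0 < \<epsilon>"
      and "\<lceil>(\<beta> * L * R / 2) / \<epsilon>\<rceil> \<le> int k" for \<beta> \<epsilon> k
  proof -
    have "(\<beta> * L * R / 2) / \<epsilon> \<le> real k" using that(5) by (simp add: ceiling_le_iff)
    then have C: "\<beta> * L * R / 2 \<le> real k * \<epsilon>" using \<open>0 < \<epsilon>\<close> by (simp add: pos_divide_le_eq)
    have pos: "0 < \<beta> * L" using \<beta>(1) assms(5) by simp
    have R: "0 \<le> R" by (simp add: R_def)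
    show ?thesis
    \<comment> \<open>The rate starts at \<open>k = 1\<close>. A bound that allows
      \<open>k = 0\<close> forces \<open>R = 0\<close>, so the run starts at
      \<open>xstar\<close>.\<close>
    proof (cases "k = 0")
      case True
      then have "R \<le> 0" using C mult_pos_pos[OF pos, of R] by fastforce
      then have "x 0 = xstar" by (simp add: R_def)
      then show ?thesis
        using True alm_s_runD(1)[OF assms(10)] \<open>0 < \<epsilon>\<close> by (simp add: eps_optimal_def)
    next
      case False
      have "1 / \<mu> \<le> \<beta> * L" using \<beta>(2) pos assms(8) by (simp add: field_simps)
      then have "R / 2 * (1 / \<mu>) \<le> R / 2 * (\<beta> * L)" using R by (intro mult_left_mono) auto
      then have D: "R / (2 * \<mu>) \<le> real k * \<epsilon>" using C by (simp add: mult_ac)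
      have "F (y k) - F xstar \<le> R / (2 * \<mu> * real (k + num_passed f g \<mu> xt y l k))"
        using start False by (intro rate) auto
      \<comment> \<open>The iteration count holds even if every test fails, so the passed tests are
        discarded.\<close>
      also have "\<dots> \<le> R / (2 * \<mu> * real k)"
        using False assms(8) R by (intro divide_left_mono mult_left_mono mult_pos_pos) auto
      also have "\<dots> = R / (2 * \<mu>) / real k" by simp
      also have "\<dots> \<le> \<epsilon>" using D False by (simp only: pos_divide_le_eq of_nat_0_less_iff mult.commute)
      finally show ?thesis by (simp add: eps_optimal_def)
    qed
  qed
  show ?thesis using rate lim eps unfolding R_def by blast
qed

end
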